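(* If $(x,u)\in\mathcal A$, then for every $x^+\in\mathbb R^{n_x}$ satisfying $$\left\Vert x^+-(Ax+Bu)\right\Vert_2\;\leq\;(1-\beta)\,r$$ there exists a control $u^+$ such that $(x^+,u^+)\in\mathcal A$.
   Context: $A\in\mathbb R^{n_x\times n_x}$, $B\in\mathbb R^{n_x\times n_u}$, and $N\ge1$ is an integer horizon. $\mathbb X=\{x\in\mathbb R^{n_x}\mid Cx\le c\}$ and $\mathbb U=\{u\in\mathbb R^{n_u}\mid Du\le d\}$ with $c>0$, $d>0$ componentwise. $X\oplus Y=\{x+y\mid x\in X,\ y\in Y\}$ is the Minkowski sum and $X\ominus Y=\{z\mid\{z\}\oplus Y\subseteq X\}$ is the Pontryagin difference. The pair $(A,B)$ is stabilizable; $K$ is a linear feedback gain and $\beta$ a constant with $\rho(A+BK)<\beta<1$, where $\rho$ is the spectral radius. $\alpha\ge\beta^N$ and $r>0$ are given constants. $Z$ is a symmetric positive definite matrix satisfying $$(A+BK)Z(A+BK)^\top\preceq\beta^2Z,\qquad r^2I\preceq Z,$$ $$C_iZC_i^\top\le(1+\alpha)^{-2}c_i^2\ \ \text{for every row }C_i\text{ of }C,\qquad D_jKZK^\top D_j^\top\le(1+\alpha)^{-2}d_j^2\ \ \text{for every row }D_j\text{ of }D,$$ and $\mathbb Z=\mathcal E(Z)=\{Z^{1/2}v\mid\Vert v\Vert_2^2\le1\}$. (The last two families of inequalities mean $(1+\alpha)\mathbb Z\subseteq\mathbb X$ and $(1+\alpha)K\mathbb Z\subseteq\mathbb U$.) For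 $k\ge0$ define $\mathbb W_k=\mathbb U\ominus(1-\beta^k)K\mathbb Z$ and $\mathbb Y_k=\mathbb X\ominus(1-\beta^k)\mathbb Z$, and let $\mathbb T=\alpha\mathbb Z$. The admissible set $\mathcal A\subseteq\mathbb R^{n_x}\times\mathbb R^{n_u}$ is the set of all pairs $(x,u)$ for which there exist sequences $y=(y_0,\dots,y_N)$ and $w=(w_0,\dots,w_{N-1})$ such that $(y_0,w_0)=(x,u)$, $y_N\in\mathbb T$, and for all $k\in\{0,\dots,N-1\}$: $(y_k,w_k)\in\mathbb Y_k\times\mathbb W_k$ and $y_{k+1}=Ay_k+Bw_k$. *)

theory Defs
  imports "HOL-Analysis.Analysis"
begin

definition complex_eigenvalues :: "real ^ 'n ^ 'n \<Rightarrow> complex set" where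
  "complex_eigenvalues M =
     {\<mu>. \<exists>v :: complex ^ 'n. v \<noteq> 0 \<and> map_matrix complex_of_real M *v v = \<mu> *s v}"

definition spectral_radius :: "real ^ 'n ^ 'n \<Rightarrow> real" where
  "spectral_radius M = (SUP \<mu>\<in>complex_eigenvalues M. cmod \<mu>)"

(* Discrete-time stabilizability: some linear state feedback makes the closed loop Schur stable. *)
definition stabilizable :: "real ^ 'n ^ 'n \<Rightarrow> real ^ 'm ^ 'n \<Rightarrow> bool" where
  "stabilizable A B \<longleftrightarrow> (\<exists>K :: real ^ 'n ^ 'm. spectral_radius (A + B ** K) < 1)"

definition pos_semidef :: "real ^ 'n ^ 'n \<Rightarrow> bool" where
  "pos_semidef M \<longleftrightarrow> transpose M = M \<and> (\<forall>v. 0 \<le> v \<bullet> (M *v v))"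

definition pos_def :: "real ^ 'n ^ 'n \<Rightarrow> bool" where
  "pos_def M \<longleftrightarrow> transpose M = M \<and> (\<forall>v. v \<noteq> 0 \<longrightarrow> 0 < v \<bullet> (M *v v))"

definition loewner_le :: "real ^ 'n ^ 'n \<Rightarrow> real ^ 'n ^ 'n \<Rightarrow> bool" where
  "loewner_le M N \<longleftrightarrow> pos_semidef (N - M)"

(* Meaningful for positive semidefinite M, where such a root exists and is unique. *)
definition matrix_sqrt :: "real ^ 'n ^ 'n \<Rightarrow> real ^ 'n ^ 'n" where
  "matrix_sqrt M = (THE S. pos_semidef S \<and> S ** S = M)"

definition ellipsoid :: "real ^ 'n ^ 'n \<Rightarrow> (real ^ 'n) set" where
  "ellipsoid Z = {matrix_sqrt Z *v v | v. (norm v)\<^sup>2 \<le> 1}"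

(* Orders on vectors are written componentwise throughout, also for c > 0: the strict
   order on vectors in the library is not the componentwise one. *)
definition polyhedral_set :: "real ^ 'n ^ 'p \<Rightarrow> real ^ 'p \<Rightarrow> (real ^ 'n) set" where
  "polyhedral_set C c = {x. \<forall>i. (C *v x) $ i \<le> c $ i}"

(* The sum of sets is the Minkowski sum of HOL-Library.Set_Algebras. *)
definition pontryagin_diff :: "'a::ab_group_add set \<Rightarrow> 'a set \<Rightarrow> 'a set"
    (infixl "\<ominus>" 65) where
  "X \<ominus> Y = {z. {z} + Y \<subseteq> X}"

definition state_tube ::
    "(real ^ 'n) set \<Rightarrow> (real ^ 'n) set \<Rightarrow> real \<Rightarrow> nat \<Rightarrow> (real ^ 'n) set" where
  "state_tube X E \<beta> k = X \<ominus> (*\<^sub>R) (1 - \<beta> ^ k) ` E"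

definition input_tube ::
    "(real ^ 'm) set \<Rightarrow> real ^ 'n ^ 'm \<Rightarrow> (real ^ 'n) set \<Rightarrow> real \<Rightarrow> nat \<Rightarrow> (real ^ 'm) set" where
  "input_tube U K E \<beta> k = U \<ominus> (*\<^sub>R) (1 - \<beta> ^ k) ` ((*v) K ` E)"

(* The finite sequences y_0, ..., y_N and w_0, ..., w_(N-1) are functions on nat of which only
   these entries are constrained. *)
definition admissible_set ::
    "nat \<Rightarrow> real ^ 'n ^ 'n \<Rightarrow> real ^ 'm ^ 'n \<Rightarrow> (nat \<Rightarrow> (real ^ 'n) set) \<Rightarrow>
     (nat \<Rightarrow> (real ^ 'm) set) \<Rightarrow> (real ^ 'n) set \<Rightarrow> ((real ^ 'n) \<times> (real ^ 'm)) set" where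
  "admissible_set N A B Y W T =
     {(x, u). \<exists>(y :: nat \<Rightarrow> real ^ 'n) (w :: nat \<Rightarrow> real ^ 'm).
        (y 0, w 0) = (x, u) \<and> y N \<in> T \<and>
        (\<forall>k<N. (y k, w k) \<in> Y k \<times> W k \<and> y (Suc k) = A *v y k + B *v w k)}"

definition tube_admissible_set ::
    "nat \<Rightarrow> real ^ 'n ^ 'n \<Rightarrow> real ^ 'm ^ 'n \<Rightarrow> real ^ 'n ^ 'p \<Rightarrow> real ^ 'p \<Rightarrow>
     real ^ 'm ^ 'q \<Rightarrow> real ^ 'q \<Rightarrow> real ^ 'n ^ 'm \<Rightarrow> real ^ 'n ^ 'n \<Rightarrow> real \<Rightarrow> real \<Rightarrow>
     ((real ^ 'n) \<times> (real ^ 'm)) set" where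
  "tube_admissible_set N A B C c D d K Z \<beta> \<alpha> =
     admissible_set N A B
       (state_tube (polyhedral_set C c) (ellipsoid Z) \<beta>)
       (input_tube (polyhedral_set D d) K (ellipsoid Z) \<beta>)
       ((*\<^sub>R) \<alpha> ` ellipsoid Z)"

end

theory Submission
  imports Defs "HOL-Computational_Algebra.Fundamental_Theorem_Algebra"
begin

text \<open>
  Let \<open>M = A + B K\<close> be the closed-loop matrix and \<open>E\<close> the ellipsoid of \<open>Z\<close>.
  Given an admissible trajectory from \<open>(x, u)\<close>, continue it beyond time \<open>N\<close> with the feedback
  \<open>w\<^sub>N = K y\<^sub>N\<close>, \<open>y\<^sub>N\<^sub>+\<^sub>1 = M y\<^sub>N\<close>, drop its first entry, and add to what remains the
  closed-loop response to the disturbance \<open>e = x' - (A x + B u)\<close>: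
  \<open>y'\<^sub>k = y\<^sub>k\<^sub>+\<^sub>1 + M\<^sup>k e\<close> and \<open>w'\<^sub>k = w\<^sub>k\<^sub>+\<^sub>1 + K M\<^sup>k e\<close>.
  This is again a trajectory of the system, and it starts at \<open>x'\<close>.

  The tightened constraints are made for this shift. Since \<open>r\<^sup>2 I \<le> Z\<close>, the disturbance lies in
  \<open>(1 - \<beta>) E\<close>; since \<open>M E \<subseteq> \<beta> E\<close>, its response \<open>M\<^sup>k e\<close> lies in \<open>\<beta>\<^sup>k (1 - \<beta>) E\<close>.
  The identity \<open>\<beta>\<^sup>k (1 - \<beta>) + (1 - \<beta>\<^sup>k) = 1 - \<beta>\<^sup>k\<^sup>+\<^sup>1\<close> says that what the constraint at stage
  \<open>k + 1\<close> reserves beyond the one at stage \<open>k\<close> is exactly enough for it. The appended entry obeys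
  the stage \<open>N\<close> constraints because \<open>\<alpha> E + (1 - \<beta>\<^sup>N) E \<subseteq> (1 + \<alpha>) E\<close>, which satisfies the original
  constraints, and the new end point lies in \<open>(\<beta> \<alpha> + \<beta>\<^sup>N (1 - \<beta>)) E \<subseteq> \<alpha> E\<close>
  because \<open>\<beta>\<^sup>N \<le> \<alpha>\<close>.

  All inclusions between multiples of \<open>E\<close> become inequalities between quadratic forms through
  the dual description in \<open>mem_scaled_ellipsoid_iff\<close>: for \<open>t \<ge> 0\<close>, \<open>z \<in> t E\<close> iff \<open>p \<bullet> z\<close> is at most
  \<open>t\<close> times the square root of \<open>p \<bullet> Z p\<close> for all \<open>p\<close>. It rests on \<open>matrix_sqrt\<close>, the
  existence and uniqueness of the positive semidefinite root, which comes from an orthonormal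
  eigenbasis. The argument also needs \<open>0 \<le> \<beta>\<close>; this follows from the hypothesis that \<open>\<beta>\<close> exceeds
  the spectral radius once the spectrum is known to be nonempty and bounded
  (\<open>spectral_radius_nonneg\<close>).
\<close>

section \<open>Nonnegativity of the spectral radius\<close>

text \<open>This is \<open>p(M) v\<close> in Horner form. Applying \<open>p(M)\<close> to a fixed vector avoids powers of a
  matrix: only the map \<open>(*v) M\<close> has to be iterated.\<close>

definition poly_apply :: "'a::field ^ 'n ^ 'n \<Rightarrow> 'a ^ 'n \<Rightarrow> 'a poly \<Rightarrow> 'a ^ 'n" where
  "poly_apply M v p = fold_coeffs (\<lambda>a w. a *s v + M *v w) p 0"

lemma poly_apply_0 [simp]: "poly_apply M v 0 = 0"
  by (simp add: poly_apply_def)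

lemma poly_apply_pCons [simp]:
  "poly_apply M v (pCons a p) = a *s v + M *v poly_apply M v p"
  by (cases "p = 0 \<and> a = 0") (auto simp: poly_apply_def)

lemma poly_apply_add: "poly_apply M v (p + q) = poly_apply M v p + poly_apply M v q"
  by (induction p q rule: poly_induct2)
     (simp_all add: vec.add vector_sadd_rdistrib algebra_simps)

lemma poly_apply_smult: "poly_apply M v (smult c p) = c *s poly_apply M v p"
  by (induction p)
     (simp_all add: vector_scalar_commute vector_add_ldistrib vector_smult_assoc)

lemma poly_apply_sum:
  "finite I \<Longrightarrow> poly_apply M v (\<Sum>i\<in>I. p i) = (\<Sum>i\<in>I. poly_apply M v (p i))"
  by (induction I rule: finite_induct) (simp_all add: poly_apply_add)

lemma poly_apply_monom: "poly_apply M v (monom c k) = c *s (((*v) M ^^ k) v)"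
  by (induction k) (simp_all add: monom_0 monom_Suc vector_scalar_commute)

text \<open>The \<open>n + 1\<close> vectors \<open>v, M v, \<dots>, M\<^sup>n v\<close> are linearly dependent in a space of dimension \<open>n\<close>.\<close>

lemma annihilating_poly_exists:
  fixes M :: "'a::field ^ 'n ^ 'n" and v :: "'a ^ 'n"
  obtains p where "p \<noteq> 0" and "poly_apply M v p = 0"
proof -
  define f where "f k = ((*v) M ^^ k) v" for k
  let ?I = "{..CARD('n)}"
  show thesis
  proof (cases "inj_on f ?I")
    case False
    then obtain i j where ij: "i \<noteq> j" "f i = f j"
      by (auto simp: inj_on_def)
    \<comment> \<open>As a set, the iterates may have too few elements to be dependent, but then two of them coincide.\<close>
    let ?p = "monom (1 :: 'a) i + smult (- 1) (monom 1 j)"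
    have "poly_apply M v ?p = 0"
      unfolding poly_apply_add poly_apply_smult poly_apply_monom
      using ij(2) by (simp add: f_def flip: vector_sneg_minus1)
    moreover have "coeff ?p i = 1"
      using ij(1) by simp
    then have "?p \<noteq> 0"
      by (metis coeff_0 zero_neq_one)
    ultimately show thesis
      by (rule that[rotated])
  next
    case True
    have "vec.dim (f ` ?I) < card (f ` ?I)"
      using dim_subset_UNIV_cart_gen[of "f ` ?I"] card_image[OF True] by simp
    then have "vec.dependent (f ` ?I)"
      by (intro vec.dependent_biggerset_general) simp
    then obtain c w where c: "w \<in> f ` ?I" "c w \<noteq> 0" "(\<Sum>w\<in>f ` ?I. c w *s w) = 0"
      by (auto simp: vec.dependent_finite)
    then obtain i where i: "i \<in> ?I" "w = f i"
      by auto
    let ?p = "\<Sum>k\<in>?I. monom (c (f k)) k"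
    have "poly_apply M v ?p = (\<Sum>k\<in>?I. c (f k) *s f k)"
      by (simp add: poly_apply_sum poly_apply_monom f_def)
    also have "\<dots> = 0"
      using c(3) by (simp add: sum.reindex[OF True])
    finally have "poly_apply M v ?p = 0" .
    moreover have "coeff ?p i = c (f i)"
      using i(1) by (simp add: coeff_sum)
    then have "?p \<noteq> 0"
      using c(2) i(2) by (metis coeff_0)
    ultimately show thesis
      by (rule that[rotated])
  qed
qed

text \<open>Let \<open>p\<close> be an annihilating polynomial of minimal degree for a vector \<open>v \<noteq> 0\<close>. It has a root
  \<open>\<mu>\<close>, so \<open>p = (X - \<mu>) q\<close>; by minimality \<open>q(M) v \<noteq> 0\<close>, and \<open>M - \<mu>\<close> sends this vector to 0.\<close>

lemma complex_matrix_eigenvector_exists: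
  fixes M :: "complex ^ 'n ^ 'n"
  obtains \<mu> w where "w \<noteq> 0" and "M *v w = \<mu> *s w"
proof -
  define v :: "complex ^ 'n" where "v = axis undefined 1"
  define P where "P p \<longleftrightarrow> p \<noteq> 0 \<and> poly_apply M v p = 0" for p
  have "v \<noteq> 0"
    by (simp add: v_def)
  obtain p0 where "P p0"
    using annihilating_poly_exists[of M v] P_def by metis
  define p where "p = arg_min degree P"
  have p: "P p" "\<And>q. P q \<Longrightarrow> degree p \<le> degree q"
    unfolding p_def using arg_min_nat_lemma[of P p0 degree] \<open>P p0\<close> by auto
  have "\<not> constant (poly p)"
  proof
    assume "constant (poly p)"
    then obtain a where "p = [:a:]"
      by (auto simp: constant_degree elim: degree_eq_zeroE)
    then show False
      using p(1) \<open>v \<noteq> 0\<close> by (auto simp: P_def)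
  qed
  then obtain \<mu> where "poly p \<mu> = 0"
    using fundamental_theorem_of_algebra by blast
  then obtain q where q: "p = [:-\<mu>, 1:] * q"
    by (auto simp: poly_eq_0_iff_dvd dvd_def)
  have "q \<noteq> 0"
    using p(1) q by (auto simp: P_def)
  then have "degree p = Suc (degree q)"
    unfolding q by (subst degree_mult_eq) auto
  then have "\<not> P q"
    using p(2)[of q] by auto
  then have "poly_apply M v q \<noteq> 0"
    using \<open>q \<noteq> 0\<close> by (simp add: P_def)
  have "p = smult (- \<mu>) q + pCons 0 q"
    using q by simp
  from arg_cong[OF this, of "poly_apply M v"]
  have "poly_apply M v p = (- \<mu>) *s poly_apply M v q + M *v poly_apply M v q"
    by (simp only: poly_apply_add poly_apply_smult poly_apply_pCons) simp
  then have "M *v poly_apply M v q = \<mu> *s poly_apply M v q"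
    using p(1) by (simp add: P_def vector_smult_lneg)
  with \<open>poly_apply M v q \<noteq> 0\<close> show thesis
    by (rule that)
qed

text \<open>A real supremum is informative only over a nonempty set that is bounded above: the eigenvector
  above gives nonemptiness, and the operator norm bounds all eigenvalues.\<close>

lemma spectral_radius_nonneg: "0 \<le> spectral_radius (M :: real ^ 'n ^ 'n)"
proof -
  let ?M = "map_matrix complex_of_real M"
  obtain b where b: "\<And>v. norm (?M *v v) \<le> norm v * b"
    using bounded_linear.bounded[OF matrix_vector_mul_bounded_linear[of ?M]] by blast
  have "cmod \<mu> \<le> b" if "\<mu> \<in> complex_eigenvalues M" for \<mu>
  proof -
    obtain v where "v \<noteq> 0" "?M *v v = \<mu> *s v"
      using \<open>\<mu> \<in> complex_eigenvalues M\<close> by (auto simp: complex_eigenvalues_def)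
    moreover have "norm (\<mu> *s v) = cmod \<mu> * norm v"
      by (simp add: norm_vec_def norm_mult L2_set_right_distrib)
    ultimately show ?thesis
      using b[of v] by (simp add: mult.commute)
  qed
  then have bdd: "bdd_above (cmod ` complex_eigenvalues M)"
    by (rule bdd_aboveI2)
  obtain \<mu> w where "w \<noteq> 0" "?M *v w = \<mu> *s w"
    by (rule complex_matrix_eigenvector_exists)
  then have "\<mu> \<in> complex_eigenvalues M"
    by (auto simp: complex_eigenvalues_def)
  then have "cmod \<mu> \<le> spectral_radius M"
    unfolding spectral_radius_def by (rule cSUP_upper[OF _ bdd])
  then show ?thesis
    using norm_ge_zero order_trans by blast
qed

section \<open>Square roots of positive semidefinite matrices\<close>

lemma inner_matrix_transpose:
  fixes M :: "real ^ 'n ^ 'm"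
  shows "u \<bullet> (M *v v) = (transpose M *v u) \<bullet> v"
  by (simp add: dot_lmul_matrix)

lemma symmetric_matrixI:
  fixes M :: "real ^ 'n ^ 'n"
  assumes "\<And>u v. u \<bullet> (M *v v) = (M *v u) \<bullet> v"
  shows "transpose M = M"
proof -
  have "transpose M *v u = M *v u" for u
    by (rule vector_eq_ldot[THEN iffD1])
       (metis assms inner_matrix_transpose inner_commute)
  then show ?thesis
    by (simp add: matrix_eq)
qed

text \<open>A maximiser \<open>v\<close> of the Rayleigh quotient on the unit sphere of the invariant subspace is an
  eigenvector. With the maximum \<open>\<mu>\<close>, the form \<open>Q u = \<mu> (u \<bullet> u) - u \<bullet> M u\<close> is nonnegative on the
  subspace and vanishes at \<open>v\<close>; a nonzero residual \<open>g = \<mu> v - M v\<close> would make \<open>Q\<close> negative a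
  little way from \<open>v\<close> in the direction \<open>- g\<close>.\<close>

lemma symmetric_eigenvector_in_subspace:
  fixes M :: "real ^ 'n ^ 'n"
  assumes sym: "transpose M = M" and W: "subspace W" "w \<in> W" "w \<noteq> 0"
    and inv: "\<And>w. w \<in> W \<Longrightarrow> M *v w \<in> W"
  obtains v \<mu> where "v \<in> W" "norm v = 1" "M *v v = \<mu> *\<^sub>R v"
proof -
  let ?S = "W \<inter> sphere 0 1"
  have "compact ?S"
    using W(1) by (intro closed_Int_compact closed_subspace) auto
  moreover have "w /\<^sub>R norm w \<in> ?S"
    using W by (auto intro: subspace_scale)
  moreover have "continuous_on ?S (\<lambda>v. v \<bullet> (M *v v))"
    by (intro continuous_intros matrix_vector_mult_linear_continuous_on)
  ultimately obtain v where v: "v \<in> ?S" and max: "\<And>u. u \<in> ?S \<Longrightarrow> u \<bullet> (M *v u) \<le> v \<bullet> (M *v v)"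
    using continuous_attains_sup[of ?S "\<lambda>v. v \<bullet> (M *v v)"] by blast
  define \<mu> where "\<mu> = v \<bullet> (M *v v)"
  define Q where "Q u = \<mu> * (u \<bullet> u) - u \<bullet> (M *v u)" for u
  define g where "g = \<mu> *\<^sub>R v - M *v v"
  have vW: "v \<in> W" and v1: "norm v = 1"
    using v by auto
  have Qnonneg: "0 \<le> Q u" if "u \<in> W" for u
  proof (cases "u = 0")
    case True
    then show ?thesis by (simp add: Q_def)
  next
    case False
    then have "u /\<^sub>R norm u \<in> ?S"
      using that W(1) by (auto intro: subspace_scale)
    from max[OF this] have "(u \<bullet> (M *v u)) / (norm u * norm u) \<le> \<mu>"
      by (simp add: \<mu>_def matrix_vector_mult_scaleR divide_simps)
    then show ?thesis
      using False by (simp add: Q_def dot_square_norm power2_eq_square field_simps)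
  qed
  have gW: "g \<in> W"
    unfolding g_def using W(1) vW inv by (intro subspace_diff subspace_scale) auto
  have expand: "Q (v - t *\<^sub>R g) = t\<^sup>2 * Q g - 2 * t * (g \<bullet> g)" for t
  proof -
    have vv: "v \<bullet> v = 1"
      using v1 by (simp add: dot_square_norm)
    have vg: "v \<bullet> (M *v g) = g \<bullet> (M *v v)"
      by (metis sym inner_matrix_transpose inner_commute)
    have gg: "g \<bullet> g = \<mu> * (g \<bullet> v) - g \<bullet> (M *v v)"
      by (subst (2) g_def) (simp add: inner_diff_right)
    show ?thesis
      unfolding Q_def
      by (simp add: vv vg gg \<mu>_def inner_diff_left inner_diff_right matrix_vector_mult_diff_distrib
          matrix_vector_mult_scaleR inner_commute power2_eq_square algebra_simps)
  qed
  have "g \<bullet> g = 0"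
  proof (rule ccontr)
    assume "g \<bullet> g \<noteq> 0"
    then have pos: "0 < g \<bullet> g"
      by simp
    \<comment> \<open>The linear term of \<open>t \<mapsto> Q (v - t g)\<close> dominates for small \<open>t\<close>; the 1 in the denominator covers \<open>Q g = 0\<close>.\<close>
    let ?t = "(g \<bullet> g) / (Q g + 1)"
    have "0 \<le> Q g" "0 < ?t"
      using Qnonneg[OF gW] pos by auto
    then have "?t * Q g < 2 * (g \<bullet> g)"
      using pos by (simp add: field_simps add_nonneg_pos)
    then have "?t * (?t * Q g) < ?t * (2 * (g \<bullet> g))"
      using \<open>0 < ?t\<close> by (rule mult_strict_left_mono)
    moreover have "0 \<le> Q (v - ?t *\<^sub>R g)"
      using Qnonneg W(1) vW gW by (metis subspace_diff subspace_scale)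
    ultimately show False
      by (simp add: expand power2_eq_square algebra_simps)
  qed
  then have "M *v v = \<mu> *\<^sub>R v"
    by (simp add: g_def)
  with vW v1 show thesis
    by (rule that)
qed

text \<open>An orthonormal set of eigenvectors of maximal size must span: otherwise its orthogonal complement
  is a nonzero invariant subspace, which contains a further eigenvector. The eigenvalue of a unit
  eigenvector \<open>b\<close> is written \<open>b \<bullet> M b\<close>, so no separate function of eigenvalues is needed.\<close>

lemma symmetric_orthonormal_eigenbasis:
  fixes M :: "real ^ 'n ^ 'n"
  assumes sym: "transpose M = M"
  obtains B where "finite B" "pairwise orthogonal B" "span B = UNIV"
    "\<And>b. b \<in> B \<Longrightarrow> norm b = 1" "\<And>b. b \<in> B \<Longrightarrow> M *v b = (b \<bullet> (M *v b)) *\<^sub>R b"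
proof -
  define P where "P B \<longleftrightarrow> pairwise orthogonal B \<and>
    (\<forall>b\<in>B. norm b = 1 \<and> M *v b = (b \<bullet> (M *v b)) *\<^sub>R b)" for B
  have bound: "finite B \<and> card B \<le> CARD('n)" if "P B" for B
  proof -
    have "independent B"
      using that by (intro pairwise_orthogonal_independent) (auto simp: P_def)
    from independent_bound[OF this] show ?thesis by simp
  qed
  have "P {}"
    by (simp add: P_def)
  then obtain B where B: "P B" and max: "\<And>B'. P B' \<Longrightarrow> card B' \<le> card B"
    using ex_has_greatest_nat[of P "{}" card "Suc CARD('n)"] bound by (metis le_imp_less_Suc)
  have "span B = UNIV"
  proof (rule ccontr)
    assume "span B \<noteq> UNIV"
    define W where "W = {w. \<forall>b\<in>B. b \<bullet> w = 0}"
    obtain a where a: "a \<noteq> 0" "\<forall>x\<in>span B. a \<bullet> x = 0"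
      using span_not_UNIV_orthogonal[OF \<open>span B \<noteq> UNIV\<close>] by blast
    then have "a \<in> W"
      by (auto simp: W_def inner_commute intro: span_base)
    have "subspace W"
      by (auto simp: W_def subspace_def inner_add_right)
    moreover have "M *v w \<in> W" if "w \<in> W" for w
    proof -
      have "b \<bullet> (M *v w) = 0" if "b \<in> B" for b
      proof -
        have "b \<bullet> (M *v w) = (M *v b) \<bullet> w"
          by (simp only: inner_matrix_transpose sym)
        also have "\<dots> = (b \<bullet> (M *v b)) * (b \<bullet> w)"
          using B \<open>b \<in> B\<close> by (metis P_def inner_scaleR_left)
        finally show ?thesis
          using \<open>w \<in> W\<close> \<open>b \<in> B\<close> by (simp add: W_def)
      qed
      then show ?thesis by (simp add: W_def)
    qed
    ultimately obtain v \<mu> where v: "v \<in> W" "norm v = 1" "M *v v = \<mu> *\<^sub>R v"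
      using symmetric_eigenvector_in_subspace[OF sym _ \<open>a \<in> W\<close> \<open>a \<noteq> 0\<close>] by blast
    have "v \<notin> B"
      using v(1,2) by (auto simp: W_def)
    have "P (insert v B)"
      using B v by (auto simp: P_def W_def pairwise_insert orthogonal_def inner_commute
          dot_square_norm)
    with max have "card (insert v B) \<le> card B" .
    then show False
      using bound[OF B] \<open>v \<notin> B\<close> by simp
  qed
  with B bound[OF B] show thesis
    by (intro that[of B]) (auto simp: P_def)
qed

text \<open>In an orthonormal eigenbasis, the root multiplies each basis vector by the square root of its
  eigenvalue.\<close>

lemma pos_semidef_sqrt_exists:
  fixes Z :: "real ^ 'n ^ 'n"
  assumes Z: "pos_semidef Z"
  obtains S where "pos_semidef S" "S ** S = Z"
proof -
  obtain B where B: "finite B" "pairwise orthogonal B" "span B = UNIV"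
    "\<And>b. b \<in> B \<Longrightarrow> norm b = 1" "\<And>b. b \<in> B \<Longrightarrow> Z *v b = (b \<bullet> (Z *v b)) *\<^sub>R b"
    using symmetric_orthonormal_eigenbasis Z unfolding pos_semidef_def by metis
  define l where "l b = sqrt (b \<bullet> (Z *v b))" for b
  have l: "0 \<le> l b" "l b * l b = b \<bullet> (Z *v b)" for b
    using Z by (simp_all add: l_def pos_semidef_def)
  define f where "f v = (\<Sum>b\<in>B. (l b * (b \<bullet> v)) *\<^sub>R b)" for v
  have "linear f"
    by (rule linearI)
       (simp_all add: f_def inner_add_right algebra_simps sum.distrib scaleR_sum_right)
  define S where "S = matrix f"
  have S: "S *v v = f v" for v
    unfolding S_def using matrix_vector_mul(2)[OF \<open>linear f\<close>] by metis
  have inner_S: "u \<bullet> (S *v v) = (\<Sum>b\<in>B. l b * ((b \<bullet> u) * (b \<bullet> v)))" for u v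
    by (simp add: S f_def inner_sum_right inner_commute mult_ac)
  have "transpose S = S"
  proof (rule symmetric_matrixI)
    fix u v
    show "u \<bullet> (S *v v) = (S *v u) \<bullet> v"
      unfolding inner_commute[of "S *v u" v] inner_S by (simp add: mult_ac)
  qed
  moreover have "0 \<le> v \<bullet> (S *v v)" for v
    unfolding inner_S by (intro sum_nonneg mult_nonneg_nonneg l zero_le_square)
  ultimately have "pos_semidef S"
    by (simp add: pos_semidef_def)
  moreover have "S ** S = Z"
  proof -
    have Sb: "S *v b = l b *\<^sub>R b" if "b \<in> B" for b
    proof -
      have "(l b' * (b' \<bullet> b)) *\<^sub>R b' = (if b' = b then l b *\<^sub>R b else 0)" if "b' \<in> B" for b'
        using B(2,4) \<open>b \<in> B\<close> that by (auto simp: pairwise_def orthogonal_def dot_square_norm)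
      then show ?thesis
        using B(1) \<open>b \<in> B\<close> by (simp add: S f_def sum.delta cong: sum.cong)
    qed
    have "(S ** S) *v b = Z *v b" if "b \<in> B" for b
      using Sb[OF that] B(5)[OF that] l(2)[of b]
      by (simp add: matrix_vector_mult_scaleR flip: matrix_vector_mul_assoc)
    then have "(S ** S) *v v = Z *v v" for v
      using linear_eq_on_span[of "(*v) (S ** S)" "(*v) Z" B v] B(3) by simp
    then show ?thesis
      by (simp add: matrix_eq)
  qed
  ultimately show thesis
    by (rule that)
qed

text \<open>With a symmetric root \<open>R\<close> of \<open>S\<close>, the number \<open>v \<bullet> S v\<close> is the squared norm of \<open>R v\<close>.\<close>

lemma pos_semidef_kernel:
  fixes S :: "real ^ 'n ^ 'n"
  assumes "pos_semidef S" "v \<bullet> (S *v v) = 0"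
  shows "S *v v = 0"
proof -
  obtain R where R: "pos_semidef R" "R ** R = S"
    using pos_semidef_sqrt_exists[OF assms(1)] .
  have "(R *v v) \<bullet> (R *v v) = v \<bullet> (S *v v)"
    using R by (metis inner_matrix_transpose matrix_vector_mul_assoc pos_semidef_def)
  then have "R *v v = 0"
    using assms(2) by simp
  then show ?thesis
    using R(2) by (metis matrix_vector_mul_assoc matrix_vector_mult_0_right)
qed

text \<open>The difference \<open>H = S - T\<close> satisfies \<open>S H + H T = S\<^sup>2 - T\<^sup>2 = 0\<close>. Evaluating this at an
  eigenvector \<open>b\<close> of \<open>H\<close> with eigenvalue \<open>m\<close> gives \<open>m (b \<bullet> S b + b \<bullet> T b) = 0\<close>; if \<open>m \<noteq> 0\<close>, both
  forms vanish at \<open>b\<close>, hence \<open>S b = T b = 0\<close> and \<open>H b = 0\<close> all the same. So \<open>H\<close> kills an eigenbasis.\<close>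

lemma pos_semidef_sqrt_unique:
  fixes S T :: "real ^ 'n ^ 'n"
  assumes S: "pos_semidef S" and T: "pos_semidef T" and eq: "S ** S = T ** T"
  shows "S = T"
proof -
  define H where "H = S - T"
  have Hv: "H *v v = S *v v - T *v v" for v
    by (simp add: H_def matrix_vector_mult_diff_rdistrib)
  have symS: "u \<bullet> (S *v v) = (S *v u) \<bullet> v" and symT: "u \<bullet> (T *v v) = (T *v u) \<bullet> v" for u v
    using S T inner_matrix_transpose unfolding pos_semidef_def by metis+
  have "transpose H = H"
    by (rule symmetric_matrixI) (simp add: Hv inner_diff_left inner_diff_right symS symT)
  then obtain B where B: "span B = UNIV" "\<And>b. b \<in> B \<Longrightarrow> H *v b = (b \<bullet> (H *v b)) *\<^sub>R b"
    using symmetric_orthonormal_eigenbasis by metis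
  have "H *v b = 0" if "b \<in> B" for b
  proof -
    define m where "m = b \<bullet> (H *v b)"
    have Hb: "H *v b = m *\<^sub>R b"
      using B(2)[OF that] by (simp add: m_def)
    have "S *v (H *v b) + H *v (T *v b) = (S ** S) *v b - (T ** T) *v b"
      by (simp add: Hv matrix_vector_mult_diff_distrib flip: matrix_vector_mul_assoc)
    then have "b \<bullet> (S *v (H *v b)) + b \<bullet> (H *v (T *v b)) = 0"
      using eq by (simp flip: inner_add_right)
    moreover have "b \<bullet> (H *v (T *v b)) = (H *v b) \<bullet> (T *v b)"
      using \<open>transpose H = H\<close> by (metis inner_matrix_transpose)
    ultimately have "m * (b \<bullet> (S *v b) + b \<bullet> (T *v b)) = 0"
      by (simp add: Hb matrix_vector_mult_scaleR algebra_simps)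
    moreover have "0 \<le> b \<bullet> (S *v b)" "0 \<le> b \<bullet> (T *v b)"
      using S T by (auto simp: pos_semidef_def)
    ultimately consider "m = 0" | "b \<bullet> (S *v b) = 0" "b \<bullet> (T *v b) = 0"
      by (auto simp: add_nonneg_eq_0_iff)
    then show ?thesis
    proof cases
      case 1
      then show ?thesis
        by (simp add: Hb)
    next
      case 2
      then have "S *v b = 0" "T *v b = 0"
        using pos_semidef_kernel S T by auto
      then show ?thesis
        by (simp add: Hv)
    qed
  qed
  then have "H *v v = 0" for v
    using linear_eq_on_span[of "(*v) H" "\<lambda>_. 0" B v] B(1) by (simp add: linear_zero)
  then have "S *v v = T *v v" for v
    using Hv[of v] by simp
  then show ?thesis
    by (simp add: matrix_eq)
qed

lemma matrix_sqrt:
  assumes "pos_semidef Z"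
  shows "pos_semidef (matrix_sqrt Z)" and "matrix_sqrt Z ** matrix_sqrt Z = Z"
proof -
  have "\<exists>!S. pos_semidef S \<and> S ** S = Z"
    using pos_semidef_sqrt_exists[OF assms] pos_semidef_sqrt_unique by metis
  from theI'[OF this]
  show "pos_semidef (matrix_sqrt Z)" and "matrix_sqrt Z ** matrix_sqrt Z = Z"
    by (simp_all add: matrix_sqrt_def)
qed

section \<open>Multiples of an ellipsoid\<close>

lemma pos_def_imp_pos_semidef: "pos_def Z \<Longrightarrow> pos_semidef Z"
  unfolding pos_def_def pos_semidef_def
  by (metis inner_zero_left less_imp_le order_refl)

text \<open>The right-hand side bounds \<open>z\<close> by the support function of \<open>t E\<close>. One direction is
  Cauchy--Schwarz. For the other, \<open>Z\<close> is invertible, and testing with the \<open>p\<close> that solves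
  \<open>Z p = z / t\<close> bounds the preimage of \<open>z / t\<close> under the root by 1. The matrix root does not
  occur in this criterion, so all later inclusions compare quadratic forms of \<open>Z\<close>.\<close>

lemma mem_scaled_ellipsoid_iff:
  fixes Z :: "real ^ 'n ^ 'n"
  assumes Z: "pos_def Z" and t: "0 \<le> t"
  shows "z \<in> (*\<^sub>R) t ` ellipsoid Z \<longleftrightarrow> (\<forall>p. p \<bullet> z \<le> t * sqrt (p \<bullet> (Z *v p)))"
proof -
  define S where "S = matrix_sqrt Z"
  have S: "transpose S = S" "S ** S = Z"
    using matrix_sqrt[OF pos_def_imp_pos_semidef[OF Z]] by (auto simp: S_def pos_semidef_def)
  have quad: "p \<bullet> (Z *v p) = (norm (S *v p))\<^sup>2" for p
    unfolding power2_norm_eq_inner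
    by (metis S inner_matrix_transpose matrix_vector_mul_assoc)
  have ell: "ellipsoid Z = {S *v v | v. norm v \<le> 1}"
    by (simp add: ellipsoid_def S_def power_le_one_iff)
  show ?thesis
  proof
    assume "z \<in> (*\<^sub>R) t ` ellipsoid Z"
    then obtain v where v: "norm v \<le> 1" "z = t *\<^sub>R (S *v v)"
      by (auto simp: ell)
    show "\<forall>p. p \<bullet> z \<le> t * sqrt (p \<bullet> (Z *v p))"
    proof
      fix p
      have "(S *v p) \<bullet> v \<le> norm (S *v p) * norm v"
        by (rule norm_cauchy_schwarz)
      also have "\<dots> \<le> norm (S *v p)"
        using v(1) by (simp add: mult_left_le)
      finally have "t * ((S *v p) \<bullet> v) \<le> t * norm (S *v p)"
        using t by (rule mult_left_mono)
      moreover have "p \<bullet> z = t * ((S *v p) \<bullet> v)"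
        by (metis S(1) v(2) inner_matrix_transpose inner_scaleR_right)
      ultimately show "p \<bullet> z \<le> t * sqrt (p \<bullet> (Z *v p))"
        by (simp add: quad)
    qed
  next
    assume supp: "\<forall>p. p \<bullet> z \<le> t * sqrt (p \<bullet> (Z *v p))"
    show "z \<in> (*\<^sub>R) t ` ellipsoid Z"
    proof (cases "t = 0")
      case True
      then have "z \<bullet> z \<le> 0"
        using supp[rule_format, of z] by simp
      then have "z = 0"
        by (metis inner_gt_zero_iff not_less)
      moreover have "0 \<in> ellipsoid Z"
        unfolding ell by (auto intro!: exI[of _ 0])
      ultimately show ?thesis
        using True by auto
    next
      case False
      have "inj ((*v) Z)"
      proof (rule linear_injective_0[THEN iffD2, rule_format])
        show "p = 0" if "Z *v p = 0" for p
          using Z that by (metis inner_zero_right less_irrefl pos_def_def)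
      qed simp
      then have "surj ((*v) Z)"
        by (simp add: linear_injective_imp_surjective)
      then obtain p where p: "Z *v p = z /\<^sub>R t"
        by (metis surjD)
      define v where "v = S *v p"
      have z: "z = t *\<^sub>R (S *v v)"
        using False p S(2) by (simp add: v_def matrix_vector_mul_assoc)
      have "p \<bullet> z = t * (p \<bullet> (Z *v p))"
        using False p by simp
      then have "t * (norm v)\<^sup>2 \<le> t * norm v"
        using supp[rule_format, of p] by (simp add: quad v_def)
      then have "norm v \<le> 1"
        using False t by (auto simp: power2_eq_square mult_le_cancel_right2)
      with z show ?thesis
        by (auto simp: ell)
    qed
  qed
qed

lemma scaled_ellipsoid_add:
  assumes "pos_def Z" "0 \<le> s" "0 \<le> t"
    and "a \<in> (*\<^sub>R) s ` ellipsoid Z" "b \<in> (*\<^sub>R) t ` ellipsoid Z"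
  shows "a + b \<in> (*\<^sub>R) (s + t) ` ellipsoid Z"
  using assms by (auto simp: mem_scaled_ellipsoid_iff inner_add_right distrib_right intro: add_mono)

lemma scaled_ellipsoid_mono:
  assumes "pos_def Z" "0 \<le> s" "s \<le> t" "a \<in> (*\<^sub>R) s ` ellipsoid Z"
  shows "a \<in> (*\<^sub>R) t ` ellipsoid Z"
proof -
  have "s * sqrt (p \<bullet> (Z *v p)) \<le> t * sqrt (p \<bullet> (Z *v p))" for p
    using pos_def_imp_pos_semidef[OF assms(1)] assms(3)
    by (intro mult_right_mono) (auto simp: pos_semidef_def)
  with assms show ?thesis
    by (auto simp: mem_scaled_ellipsoid_iff intro: order_trans)
qed

text \<open>The support function of the image under \<open>M\<close> at \<open>p\<close> is that of \<open>E\<close> at \<open>M\<^sup>T p\<close>, which the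
  Lyapunov inequality compares with \<open>\<beta>\<close> times that of \<open>E\<close> at \<open>p\<close>.\<close>

lemma scaled_ellipsoid_contract:
  fixes M Z :: "real ^ 'n ^ 'n"
  assumes Z: "pos_def Z" and \<beta>: "0 \<le> \<beta>" and t: "0 \<le> t"
    and lyap: "loewner_le (M ** Z ** transpose M) (\<beta>\<^sup>2 *\<^sub>R Z)"
    and a: "a \<in> (*\<^sub>R) t ` ellipsoid Z"
  shows "M *v a \<in> (*\<^sub>R) (\<beta> * t) ` ellipsoid Z"
proof -
  have "p \<bullet> (M *v a) \<le> \<beta> * t * sqrt (p \<bullet> (Z *v p))" for p
  proof -
    let ?q = "transpose M *v p"
    have "p \<bullet> ((M ** Z ** transpose M) *v p) \<le> p \<bullet> ((\<beta>\<^sup>2 *\<^sub>R Z) *v p)"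
      using lyap by (simp add: loewner_le_def pos_semidef_def
          matrix_vector_mult_diff_rdistrib inner_diff_right)
    moreover have "p \<bullet> ((M ** Z ** transpose M) *v p) = ?q \<bullet> (Z *v ?q)"
      by (metis inner_matrix_transpose matrix_vector_mul_assoc)
    ultimately have "?q \<bullet> (Z *v ?q) \<le> \<beta>\<^sup>2 * (p \<bullet> (Z *v p))"
      by (simp flip: scaleR_matrix_vector_assoc)
    then have "sqrt (?q \<bullet> (Z *v ?q)) \<le> \<beta> * sqrt (p \<bullet> (Z *v p))"
      using \<beta> by (metis real_sqrt_abs real_sqrt_le_iff real_sqrt_mult abs_of_nonneg)
    then have "t * sqrt (?q \<bullet> (Z *v ?q)) \<le> t * (\<beta> * sqrt (p \<bullet> (Z *v p)))"
      using t by (rule mult_left_mono)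
    moreover have "p \<bullet> (M *v a) = ?q \<bullet> a"
      by (rule inner_matrix_transpose)
    moreover have "?q \<bullet> a \<le> t * sqrt (?q \<bullet> (Z *v ?q))"
      using a mem_scaled_ellipsoid_iff[OF Z t] by blast
    ultimately show ?thesis
      by (simp add: mult_ac)
  qed
  then show ?thesis
    using mem_scaled_ellipsoid_iff[OF Z] \<beta> t by simp
qed

lemma scaled_ellipsoid_funpow:
  fixes M Z :: "real ^ 'n ^ 'n"
  assumes "pos_def Z" "0 \<le> \<beta>" "0 \<le> t"
    and "loewner_le (M ** Z ** transpose M) (\<beta>\<^sup>2 *\<^sub>R Z)"
    and "a \<in> (*\<^sub>R) t ` ellipsoid Z"
  shows "((*v) M ^^ k) a \<in> (*\<^sub>R) (\<beta> ^ k * t) ` ellipsoid Z"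
proof (induction k)
  case 0
  then show ?case using assms(5) by simp
next
  case (Suc k)
  then show ?case
    using scaled_ellipsoid_contract[OF assms(1,2) _ assms(4) Suc.IH] assms(2,3)
    by (simp add: mult_ac)
qed

lemma cball_subset_scaled_ellipsoid:
  fixes Z :: "real ^ 'n ^ 'n"
  assumes Z: "pos_def Z" and r: "0 \<le> r" "loewner_le (r\<^sup>2 *\<^sub>R mat 1) Z"
    and t: "0 \<le> t" and a: "norm a \<le> t * r"
  shows "a \<in> (*\<^sub>R) t ` ellipsoid Z"
proof -
  have "p \<bullet> a \<le> t * sqrt (p \<bullet> (Z *v p))" for p
  proof -
    have "r\<^sup>2 * (p \<bullet> p) \<le> p \<bullet> (Z *v p)"
      using r(2) by (simp add: loewner_le_def pos_semidef_def
          matrix_vector_mult_diff_rdistrib inner_diff_right flip: scaleR_matrix_vector_assoc)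
    then have "r * norm p \<le> sqrt (p \<bullet> (Z *v p))"
      by (intro real_le_rsqrt) (simp add: power_mult_distrib power2_norm_eq_inner)
    then have "t * (r * norm p) \<le> t * sqrt (p \<bullet> (Z *v p))"
      using t by (rule mult_left_mono)
    moreover have "p \<bullet> a \<le> norm p * norm a"
      by (rule norm_cauchy_schwarz)
    moreover have "norm p * norm a \<le> norm p * (t * r)"
      using a by (intro mult_left_mono) auto
    ultimately show ?thesis
      by (simp add: mult_ac)
  qed
  then show ?thesis
    using mem_scaled_ellipsoid_iff[OF Z t] by blast
qed

lemma scaled_ellipsoid_halfspace:
  fixes Z :: "real ^ 'n ^ 'n"
  assumes Z: "pos_def Z" and t: "0 < t" and \<gamma>: "0 < \<gamma>"
    and g: "g \<bullet> (Z *v g) \<le> inverse (t\<^sup>2) * \<gamma>\<^sup>2"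
    and a: "a \<in> (*\<^sub>R) t ` ellipsoid Z"
  shows "g \<bullet> a \<le> \<gamma>"
proof -
  have "sqrt (g \<bullet> (Z *v g)) \<le> \<gamma> / t"
    using g t \<gamma> by (intro real_le_lsqrt) (auto simp: power_divide divide_inverse mult.commute power_mult_distrib power_inverse)
  then have "t * sqrt (g \<bullet> (Z *v g)) \<le> \<gamma>"
    using t by (simp add: field_simps)
  moreover have "g \<bullet> a \<le> t * sqrt (g \<bullet> (Z *v g))"
    using a t mem_scaled_ellipsoid_iff[OF Z, of t a] by simp
  ultimately show ?thesis
    by linarith
qed

text \<open>Stated for an image \<open>L E\<close> so as to serve both constraints: the gain \<open>L = K\<close> gives the input
  constraint, and \<open>L = I\<close> the state constraint.\<close>

lemma polyhedral_set_image_scaled_ellipsoid: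
  fixes Z :: "real ^ 'n ^ 'n" and L :: "real ^ 'n ^ 'm" and D :: "real ^ 'm ^ 'q"
  assumes "pos_def Z" "0 < t" "\<forall>j. 0 < d $ j"
    and D: "\<forall>j. row j D \<bullet> ((L ** Z ** transpose L) *v row j D) \<le> inverse (t\<^sup>2) * (d $ j)\<^sup>2"
    and a: "a \<in> (*\<^sub>R) t ` ellipsoid Z"
  shows "L *v a \<in> polyhedral_set D d"
proof -
  have "(D *v (L *v a)) $ j \<le> d $ j" for j
  proof -
    let ?g = "transpose L *v row j D"
    have "row j D \<bullet> ((L ** Z ** transpose L) *v row j D) = ?g \<bullet> (Z *v ?g)"
      by (metis inner_matrix_transpose matrix_vector_mul_assoc)
    then have "?g \<bullet> (Z *v ?g) \<le> inverse (t\<^sup>2) * (d $ j)\<^sup>2"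
      using D by metis
    then have "?g \<bullet> a \<le> d $ j"
      using scaled_ellipsoid_halfspace assms(1-3) a by blast
    moreover have "(D *v (L *v a)) $ j = row j D \<bullet> (L *v a)"
      by (simp add: matrix_vector_mul_component row_def)
    ultimately show ?thesis
      by (simp only: inner_matrix_transpose)
  qed
  then show ?thesis
    by (simp add: polyhedral_set_def)
qed

section \<open>Tightened constraints\<close>

lemma mem_pontryagin_diff_iff: "z \<in> X \<ominus> Y \<longleftrightarrow> (\<forall>y\<in>Y. z + y \<in> X)"
  by (auto simp: pontryagin_diff_def set_plus_def)

text \<open>If \<open>y + Q \<subseteq> Y\<close>, the margin \<open>Y\<close> has room for the perturbation \<open>y\<close> and still leaves \<open>Q\<close>.\<close>

lemma pontryagin_diff_shift:
  assumes "z \<in> X \<ominus> Y" "\<And>q. q \<in> Q \<Longrightarrow> y + q \<in> Y"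
  shows "z + y \<in> X \<ominus> Q"
  using assms by (auto simp: mem_pontryagin_diff_iff add.assoc)

text \<open>Scaling before applying \<open>K\<close> makes the margin an image of a multiple of \<open>E\<close>, so that facts about
  those multiples carry over to inputs.\<close>

lemma input_tube_eq:
  "input_tube U K E \<beta> k = U \<ominus> (*v) K ` (*\<^sub>R) (1 - \<beta> ^ k) ` E"
  by (simp add: input_tube_def image_image matrix_vector_mult_scaleR)

section \<open>Recursive feasibility\<close>

theorem lemma2:
  fixes A :: "real ^ 'nx ^ 'nx"
    and B :: "real ^ 'nu ^ 'nx"
    and C :: "real ^ 'nx ^ 'p" and c :: "real ^ 'p"
    and D :: "real ^ 'nu ^ 'q" and d :: "real ^ 'q"
    and K :: "real ^ 'nx ^ 'nu"
    and Z :: "real ^ 'nx ^ 'nx"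
    and \<alpha> \<beta> r :: real
    and N :: nat
    and x :: "real ^ 'nx" and u :: "real ^ 'nu"
  assumes "N \<ge> 1"
    and "\<forall>i. 0 < c $ i" and "\<forall>j. 0 < d $ j"
    and "stabilizable A B"
    and "spectral_radius (A + B ** K) < \<beta>" and "\<beta> < 1"
    and "\<alpha> \<ge> \<beta> ^ N" and "r > 0"
    and "pos_def Z"
    and "loewner_le ((A + B ** K) ** Z ** transpose (A + B ** K)) (\<beta>\<^sup>2 *\<^sub>R Z)"
    and "loewner_le (r\<^sup>2 *\<^sub>R mat 1) Z"
    and "\<forall>i. row i C \<bullet> (Z *v row i C) \<le> inverse ((1 + \<alpha>)\<^sup>2) * (c $ i)\<^sup>2"
    and "\<forall>j. row j D \<bullet> ((K ** Z ** transpose K) *v row j D) \<le> inverse ((1 + \<alpha>)\<^sup>2) * (d $ j)\<^sup>2"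
    and "(x, u) \<in> tube_admissible_set N A B C c D d K Z \<beta> \<alpha>"
  shows "\<forall>x' :: real ^ 'nx. norm (x' - (A *v x + B *v u)) \<le> (1 - \<beta>) * r \<longrightarrow>
           (\<exists>u' :: real ^ 'nu. (x', u') \<in> tube_admissible_set N A B C c D d K Z \<beta> \<alpha>)"
proof (intro allI impI)
  fix x' :: "real ^ 'nx"
  assume x': "norm (x' - (A *v x + B *v u)) \<le> (1 - \<beta>) * r"
  note Z = \<open>pos_def Z\<close>
  define M where "M = A + B ** K"
  define E where "E t = (*\<^sub>R) t ` ellipsoid Z" for t
  define X where "X = polyhedral_set C c"
  define U where "U = polyhedral_set D d"
  define Y where "Y = state_tube X (ellipsoid Z) \<beta>"
  define W where "W = input_tube U K (ellipsoid Z) \<beta>"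
  have Yk: "Y k = X \<ominus> E (1 - \<beta> ^ k)" and Wk: "W k = U \<ominus> (*v) K ` E (1 - \<beta> ^ k)" for k
    by (simp_all add: Y_def W_def E_def state_tube_def input_tube_eq)
  have adm: "tube_admissible_set N A B C c D d K Z \<beta> \<alpha> = admissible_set N A B Y W (E \<alpha>)"
    by (simp add: tube_admissible_set_def X_def U_def Y_def W_def E_def)
  have \<beta>0: "0 \<le> \<beta>"
    using spectral_radius_nonneg[of "A + B ** K"] \<open>spectral_radius (A + B ** K) < \<beta>\<close> by linarith
  have pow: "0 \<le> \<beta> ^ k" "\<beta> ^ k \<le> 1" for k
    using \<beta>0 \<open>\<beta> < 1\<close> by (auto intro: power_le_one)
  have \<alpha>0: "0 \<le> \<alpha>"
    using pow(1)[of N] \<open>\<alpha> \<ge> \<beta> ^ N\<close> by linarith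
  have E_add: "a + b \<in> E (s + t)" if "0 \<le> s" "0 \<le> t" "a \<in> E s" "b \<in> E t" for a b s t
    using scaled_ellipsoid_add[OF Z] that by (simp add: E_def)
  have E_mono: "a \<in> E t" if "0 \<le> s" "s \<le> t" "a \<in> E s" for a s t
    using scaled_ellipsoid_mono[OF Z] that by (simp add: E_def)
  have lyap: "loewner_le (M ** Z ** transpose M) (\<beta>\<^sup>2 *\<^sub>R Z)"
    using assms(10) by (simp add: M_def)
  have EX: "a \<in> X" if "a \<in> E (1 + \<alpha>)" for a
    using polyhedral_set_image_scaled_ellipsoid[OF Z _ assms(2), of "1 + \<alpha>" C "mat 1" a]
      \<alpha>0 assms(12) that by (simp add: X_def E_def)
  have EU: "K *v a \<in> U" if "a \<in> E (1 + \<alpha>)" for a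
    using polyhedral_set_image_scaled_ellipsoid[OF Z _ assms(3), of "1 + \<alpha>" D K a]
      \<alpha>0 assms(13) that by (simp add: U_def E_def)

  obtain y w where yw: "y 0 = x" "w 0 = u" "y N \<in> E \<alpha>"
    "\<And>k. k < N \<Longrightarrow> y k \<in> Y k \<and> w k \<in> W k \<and> y (Suc k) = A *v y k + B *v w k"
    using assms(14) unfolding adm admissible_set_def by auto
  \<comment> \<open>The given trajectory is continued for one stage by the feedback \<open>K\<close>.\<close>
  define y2 where "y2 = y(Suc N := M *v y N)"
  define w2 where "w2 = w(N := K *v y N)"
  have M_split: "M *v v = A *v v + B *v (K *v v)" for v
    by (simp add: M_def matrix_vector_mult_add_rdistrib matrix_vector_mul_assoc)
  have tail: "y N + q \<in> E (1 + \<alpha>)" if "q \<in> E (1 - \<beta> ^ N)" for q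
    using E_add[of \<alpha> "1 - \<beta> ^ N" "y N" q] E_mono[of "\<alpha> + (1 - \<beta> ^ N)" "1 + \<alpha>" "y N + q"]
      yw(3) that \<alpha>0 pow[of N] by simp
  have ext: "y2 k \<in> Y k \<and> w2 k \<in> W k \<and> y2 (Suc k) = A *v y2 k + B *v w2 k" if "k \<le> N" for k
  proof (cases "k = N")
    case True
    have "y N \<in> Y N"
      using tail EX by (auto simp: Yk mem_pontryagin_diff_iff)
    moreover have "K *v y N \<in> W N"
      using tail EU by (auto simp: Wk mem_pontryagin_diff_iff simp flip: matrix_vector_right_distrib)
    ultimately show ?thesis
      using True by (simp add: y2_def w2_def M_split)
  next
    case False
    then show ?thesis
      using that yw(4)[of k] by (auto simp: y2_def w2_def)
  qed

  define e where "e = x' - (A *v x + B *v u)"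
  \<comment> \<open>The response of the closed loop to the disturbance.\<close>
  define \<delta> where "\<delta> k = ((*v) M ^^ k) e" for k
  have \<delta>: "\<delta> k \<in> E (\<beta> ^ k * (1 - \<beta>))" for k
  proof -
    have "e \<in> (*\<^sub>R) (1 - \<beta>) ` ellipsoid Z"
      using cball_subset_scaled_ellipsoid[OF Z _ assms(11), of "1 - \<beta>" e] x' \<open>r > 0\<close> \<open>\<beta> < 1\<close>
      by (simp add: e_def)
    from scaled_ellipsoid_funpow[OF Z \<beta>0 _ lyap this] \<open>\<beta> < 1\<close>
    show ?thesis by (simp add: \<delta>_def E_def)
  qed
  \<comment> \<open>The margins of consecutive stages differ by what \<open>\<delta> k\<close> needs.\<close>
  have absorb: "\<delta> k + q \<in> E (1 - \<beta> ^ Suc k)" if "q \<in> E (1 - \<beta> ^ k)" for k q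
  proof -
    have "\<delta> k + q \<in> E (\<beta> ^ k * (1 - \<beta>) + (1 - \<beta> ^ k))"
      using pow[of k] \<open>\<beta> < 1\<close> by (intro E_add \<delta> that) auto
    then show ?thesis
      by (simp add: algebra_simps)
  qed

  define y' where "y' k = y2 (Suc k) + \<delta> k" for k
  define w' where "w' k = w2 (Suc k) + K *v \<delta> k" for k
  have "y' 0 = x'"
    using ext[of 0] yw(1,2) \<open>N \<ge> 1\<close> by (simp add: y'_def \<delta>_def e_def y2_def w2_def)
  moreover have "y' N \<in> E \<alpha>"
  proof -
    have "M *v y N \<in> E (\<beta> * \<alpha>)"
      using scaled_ellipsoid_contract[OF Z \<beta>0 \<alpha>0 lyap] yw(3) by (simp add: E_def)
    from E_add[OF _ _ this \<delta>[of N]]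
    have "y' N \<in> E (\<beta> * \<alpha> + \<beta> ^ N * (1 - \<beta>))"
      using \<beta>0 \<alpha>0 pow \<open>\<beta> < 1\<close> by (simp add: y'_def y2_def)
    moreover have "\<beta> ^ N * (1 - \<beta>) \<le> \<alpha> * (1 - \<beta>)"
      using \<open>\<alpha> \<ge> \<beta> ^ N\<close> \<open>\<beta> < 1\<close> by (intro mult_right_mono) auto
    then have "\<beta> * \<alpha> + \<beta> ^ N * (1 - \<beta>) \<le> \<alpha>"
      by (simp add: algebra_simps)
    ultimately show ?thesis
      using E_mono \<beta>0 \<alpha>0 pow \<open>\<beta> < 1\<close> by (meson add_nonneg_nonneg diff_ge_0_iff_ge less_imp_le mult_nonneg_nonneg)
  qed
  moreover have "y' k \<in> Y k \<and> w' k \<in> W k \<and> y' (Suc k) = A *v y' k + B *v w' k" if "k < N" for k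
  proof (intro conjI)
    have step: "y2 (Suc k) \<in> Y (Suc k)" "w2 (Suc k) \<in> W (Suc k)"
      "y2 (Suc (Suc k)) = A *v y2 (Suc k) + B *v w2 (Suc k)"
      using ext[of "Suc k"] that by auto
    show "y' k \<in> Y k"
      unfolding y'_def Yk
      using step(1)[unfolded Yk] absorb by (rule pontryagin_diff_shift)
    show "w' k \<in> W k"
      unfolding w'_def Wk using step(2)[unfolded Wk]
    proof (rule pontryagin_diff_shift)
      fix q
      assume "q \<in> (*v) K ` E (1 - \<beta> ^ k)"
      then show "K *v \<delta> k + q \<in> (*v) K ` E (1 - \<beta> ^ Suc k)"
        using absorb by (auto simp flip: matrix_vector_right_distrib)
    qed
    have "\<delta> (Suc k) = A *v \<delta> k + B *v (K *v \<delta> k)"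
      by (simp add: \<delta>_def M_split)
    then show "y' (Suc k) = A *v y' k + B *v w' k"
      using step(3) by (simp add: y'_def w'_def matrix_vector_right_distrib)
  qed
  ultimately have "(x', w' 0) \<in> tube_admissible_set N A B C c D d K Z \<beta> \<alpha>"
    unfolding adm admissible_set_def by auto
  then show "\<exists>u'. (x', u') \<in> tube_admissible_set N A B C c D d K Z \<beta> \<alpha>"
    by blast
qed

end
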